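(* Let $\alpha\ge 1$ be an integer and let $a_1,a_2,a_3,b$ be integers. If $a_1a_2a_3\in\mathbb{Z}_2^*$ (that is, $a_1a_2a_3$ is odd), then $$\operatorname{rb}(\mathbb{Z}_{2^\alpha},\operatorname{eq}(a_1,a_2,a_3,b))=\alpha+2.$$
   Context: $\mathbb{Z}_n$ denotes the integers modulo $n$ and $[r]=\{1,\dots,r\}$. An exact $r$-coloring of $\mathbb{Z}_n$ is a surjective function $c:\mathbb{Z}_n\to[r]$. $\operatorname{eq}(a_1,a_2,a_3,b)$ denotes the equation $a_1x_1+a_2x_2+a_3x_3=b$; a solution in $\mathbb{Z}_n$ is an ordered triple $(s_1,s_2,s_3)$ of elements of $\mathbb{Z}_n$ with $a_1s_1+a_2s_2+a_3s_3\equiv b \pmod n$. A solution is rainbow (with respect to $c$) if $|\{c(s_1),c(s_2),c(s_3)\}|=3$. The rainbow number $\operatorname{rb}(\mathbb{Z}_n,eq)$ is the smallest positive integer $r$ such that every exact $r$-coloring of $\mathbb{Z}_n$ has a rainbow solution to $eq$; by convention it equals $n+1$ if an exact $n$-coloring of $\mathbb{Z}_n$ contains no rainbow solution. *)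

theory Defs
  imports "HOL-Number_Theory.Number_Theory"
begin

text \<open>
  The ring of integers modulo n is rendered by the carrier of the library's
  \<^const>\<open>residue_ring\<close>, i.e. by the representatives 0, ..., n - 1.
  A colouring is a total function on the integers; only its values on that carrier matter.
\<close>

abbreviation Zmod :: "nat \<Rightarrow> int set" where
  "Zmod n \<equiv> carrier (residue_ring (int n))"

definition exact_coloring :: "nat \<Rightarrow> nat \<Rightarrow> (int \<Rightarrow> nat) \<Rightarrow> bool" where
  "exact_coloring n r c \<longleftrightarrow> c ` Zmod n = {1..r}"

definition is_solution ::
    "nat \<Rightarrow> int \<Rightarrow> int \<Rightarrow> int \<Rightarrow> int \<Rightarrow> int \<Rightarrow> int \<Rightarrow> int \<Rightarrow> bool" where
  "is_solution n a1 a2 a3 b s1 s2 s3 \<longleftrightarrow>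
     s1 \<in> Zmod n \<and> s2 \<in> Zmod n \<and> s3 \<in> Zmod n \<and>
     [a1 * s1 + a2 * s2 + a3 * s3 = b] (mod int n)"

definition has_rainbow_solution ::
    "nat \<Rightarrow> int \<Rightarrow> int \<Rightarrow> int \<Rightarrow> int \<Rightarrow> (int \<Rightarrow> nat) \<Rightarrow> bool" where
  "has_rainbow_solution n a1 a2 a3 b c \<longleftrightarrow>
     (\<exists>s1 s2 s3. is_solution n a1 a2 a3 b s1 s2 s3 \<and> card {c s1, c s2, c s3} = 3)"

text \<open>
  The first branch is the usual convention for the value n + 1. In the second branch
  (for positive n) the value r = n satisfies the condition, so the minimum is attained.
\<close>

definition rainbow_number :: "nat \<Rightarrow> int \<Rightarrow> int \<Rightarrow> int \<Rightarrow> int \<Rightarrow> nat" where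
  "rainbow_number n a1 a2 a3 b =
     (if \<exists>c. exact_coloring n n c \<and> \<not> has_rainbow_solution n a1 a2 a3 b c
      then n + 1
      else (LEAST r. 0 < r \<and>
              (\<forall>c. exact_coloring n r c \<longrightarrow> has_rainbow_solution n a1 a2 a3 b c)))"

end

theory Submission
  imports Defs
begin

text \<open>
  The coefficient sum \<open>a1 + a2 + a3\<close> is odd, hence invertible modulo \<open>2 ^ \<alpha>\<close>, so some constant
  triple \<open>(t, t, t)\<close> solves the equation. Measuring every \<open>x\<close> by its distance \<open>x - t\<close> turns the
  equation into the homogeneous one, \<open>b = 0\<close>.

  For the lower bound, colour \<open>x\<close> by the 2-adic valuation of \<open>x - t\<close>, which takes the \<open>\<alpha> + 1\<close> values
  \<open>0, \<dots>, \<alpha>\<close> once \<open>0\<close> is given valuation \<open>\<alpha>\<close>. As all coefficients are odd, in a vanishing sum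
  the smallest valuation cannot occur only once, so no solution is rainbow
  (\<open>capped_val_solution\<close>). Capping the valuation earlier merges colours and settles every smaller
  number of colours (\<open>exact_coloring_without_rainbow\<close>).

  The upper bound goes by induction on \<open>\<alpha>\<close>: a rainbow-free colouring uses at most \<open>\<alpha> + 1\<close> colours
  (\<open>card_range_rainbow_free\<close>). The even residues modulo \<open>2 ^ (\<alpha> + 1)\<close> are a copy of the residues
  modulo \<open>2 ^ \<alpha>\<close>, to which the induction hypothesis applies. The odd residues contribute at
  most one further colour: if \<open>x\<close> and \<open>y\<close> were odd and had two different colours, neither of them
  used on even residues, then the \<open>z\<close> that completes \<open>x\<close> and \<open>y\<close> to a solution would be even,
  hence of a third colour.
\<close>

section \<open>Linear congruences modulo powers of two\<close>

lemma odd_linear_congruence_solvable: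
  fixes a b :: int
  assumes "odd a"
  obtains t where "[a * t = b] (mod 2 ^ k)"
proof -
  have "coprime a (2 ^ k)"
    using assms by simp
  then obtain u where u: "[a * u = 1] (mod 2 ^ k)"
    using cong_solve_coprime_int by blast
  have "[a * u * b = 1 * b] (mod 2 ^ k)"
    using u by (rule cong_scalar_right)
  then show thesis
    using that[of "u * b"] by (simp add: mult.assoc)
qed

section \<open>The valuation colouring\<close>

text \<open>
  The cap gives \<open>0\<close> a finite valuation and makes the number of values adjustable.
\<close>

definition capped_val :: "nat \<Rightarrow> int \<Rightarrow> nat" where
  "capped_val m x = Max {i. i \<le> m \<and> 2 ^ i dvd x}"

lemma capped_val_le: "capped_val m x \<le> m"
  and le_capped_val_iff: "i \<le> m \<Longrightarrow> i \<le> capped_val m x \<longleftrightarrow> 2 ^ i dvd x"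
proof -
  let ?S = "{i. i \<le> m \<and> 2 ^ i dvd x}"
  have fin: "finite ?S"
    by simp
  have "0 \<in> ?S"
    by simp
  with fin have mem: "capped_val m x \<in> ?S"
    unfolding capped_val_def using Max_in by blast
  then show "capped_val m x \<le> m"
    by simp
  show "i \<le> capped_val m x \<longleftrightarrow> 2 ^ i dvd x" if "i \<le> m"
  proof
    assume "i \<le> capped_val m x"
    then show "2 ^ i dvd x"
      using mem by (metis (mono_tags, lifting) dvd_trans le_imp_power_dvd mem_Collect_eq)
  next
    assume "2 ^ i dvd x"
    then show "i \<le> capped_val m x"
      unfolding capped_val_def using fin that by (intro Max_ge) auto
  qed
qed

lemma capped_val_cong:
  assumes "[x = y] (mod 2 ^ k)" "m \<le> k"
  shows "capped_val m x = capped_val m y"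
proof -
  have "2 ^ i dvd x \<longleftrightarrow> 2 ^ i dvd y" if "i \<le> m" for i
  proof -
    have "(2 :: int) ^ i dvd 2 ^ k"
      using that assms(2) by (simp add: le_imp_power_dvd)
    then show ?thesis
      using assms(1) cong_dvd_iff cong_dvd_modulus by blast
  qed
  then show ?thesis
    unfolding capped_val_def by (metis (no_types, lifting))
qed

lemma capped_val_power:
  assumes "i \<le> m"
  shows "capped_val m (2 ^ i) = i"
proof (rule antisym)
  have "2 ^ capped_val m (2 ^ i) dvd (2 :: int) ^ i"
    using le_capped_val_iff[OF capped_val_le] by blast
  then show "capped_val m (2 ^ i) \<le> i"
    by (simp add: dvd_power_iff)
  show "i \<le> capped_val m (2 ^ i)"
    using assms by (simp add: le_capped_val_iff)
qed

text \<open>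
  If the valuation of \<open>u1\<close> were the strictly smallest, the next power of two would divide all
  terms but \<open>a1 * u1\<close>, and therefore \<open>u1\<close> as well because \<open>a1\<close> is odd. The cap must not exceed
  \<open>k\<close> so that this power still divides the modulus.
\<close>

lemma capped_val_not_strict_min:
  assumes "odd a1" "2 ^ k dvd a1 * u1 + a2 * u2 + a3 * u3" "m \<le> k"
    and "capped_val m u1 < capped_val m u2" "capped_val m u1 < capped_val m u3"
  shows False
proof -
  define j where "j = Suc (capped_val m u1)"
  have j: "j \<le> m"
    using assms(4) capped_val_le[of m u2] by (simp add: j_def)
  have "2 ^ j dvd u2" "2 ^ j dvd u3"
    using assms(4,5) le_capped_val_iff[OF j] by (simp_all add: j_def Suc_le_eq)
  moreover have "2 ^ j dvd a1 * u1 + a2 * u2 + a3 * u3"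
    using assms(2,3) j by (meson dvd_trans le_imp_power_dvd le_trans)
  ultimately have "2 ^ j dvd a1 * u1"
    by (metis dvd_add_left_iff dvd_mult)
  moreover have "coprime (2 ^ j) a1"
    using assms(1) by simp
  ultimately have "2 ^ j dvd u1"
    by (simp add: coprime_dvd_mult_right_iff)
  then show False
    using le_capped_val_iff[OF j, of u1] by (simp add: j_def del: power_Suc)
qed

text \<open>
  Among three pairwise different valuations one is the strict minimum, and the equation is
  symmetric in its terms.
\<close>

lemma capped_val_solution:
  assumes "odd a1" "odd a2" "odd a3"
    and "2 ^ k dvd a1 * u1 + a2 * u2 + a3 * u3" "m \<le> k"
  shows "capped_val m u1 = capped_val m u2 \<or> capped_val m u1 = capped_val m u3
    \<or> capped_val m u2 = capped_val m u3"
proof (rule ccontr)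
  assume neq: "\<not> ?thesis"
  have perm: "2 ^ k dvd a2 * u2 + a1 * u1 + a3 * u3" "2 ^ k dvd a3 * u3 + a1 * u1 + a2 * u2"
    using assms(4) by (simp_all add: ac_simps)
  show False
    using capped_val_not_strict_min[OF assms(1,4,5)]
      capped_val_not_strict_min[OF assms(2) perm(1) assms(5)]
      capped_val_not_strict_min[OF assms(3) perm(2) assms(5)] neq
    by linarith
qed

section \<open>Residues and solutions\<close>

lemma carrier_residue_ring_eq: "carrier (residue_ring n) = {0..<n}"
  by (auto simp: residue_ring_def)

lemma card_three_iff: "card {x, y, z} = 3 \<longleftrightarrow> x \<noteq> y \<and> x \<noteq> z \<and> y \<noteq> z"
  by (auto simp: card_insert_if)

text \<open>
  Subtracting a constant solution \<open>t\<close> makes the equation homogeneous.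
\<close>

lemma linear_cong_translate:
  fixes a1 a2 a3 b t n :: int
  assumes "[(a1 + a2 + a3) * t = b] (mod n)"
  shows "[a1 * x + a2 * y + a3 * z = b] (mod n)
    \<longleftrightarrow> n dvd a1 * (x - t) + a2 * (y - t) + a3 * (z - t)"
proof -
  have "[a1 * x + a2 * y + a3 * z = b] (mod n)
      \<longleftrightarrow> [a1 * x + a2 * y + a3 * z = (a1 + a2 + a3) * t] (mod n)"
    using assms cong_sym cong_trans by blast
  also have "\<dots> \<longleftrightarrow> n dvd a1 * x + a2 * y + a3 * z - (a1 + a2 + a3) * t"
    by (rule cong_iff_dvd_diff)
  also have "a1 * x + a2 * y + a3 * z - (a1 + a2 + a3) * t
      = a1 * (x - t) + a2 * (y - t) + a3 * (z - t)"
    by (simp add: algebra_simps)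
  finally show ?thesis .
qed

section \<open>The lower bound\<close>

lemma exact_coloring_without_rainbow:
  fixes a1 a2 a3 b :: int
  assumes odd: "odd a1" "odd a2" "odd a3"
    and r: "0 < r" "r \<le> k + 1"
  obtains c where "exact_coloring (2 ^ k) r c"
    "\<not> has_rainbow_solution (2 ^ k) a1 a2 a3 b c"
proof -
  have "odd (a1 + a2 + a3)"
    using odd by simp
  then obtain t where t: "[(a1 + a2 + a3) * t = b] (mod 2 ^ k)"
    by (rule odd_linear_congruence_solvable)
  \<comment> \<open>The valuations \<open>0, \<dots>, r - 1\<close> become the colours \<open>1, \<dots>, r\<close>.\<close>
  define m where "m = r - 1"
  have m: "m \<le> k" "r = Suc m"
    using r by (auto simp: m_def)
  define c where "c x = Suc (capped_val m (x - t))" for x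
  have "c ` Zmod (2 ^ k) = {1..r}"
  proof
    show "c ` Zmod (2 ^ k) \<subseteq> {1..r}"
      using capped_val_le[of m] by (auto simp: c_def m(2))
    show "{1..r} \<subseteq> c ` Zmod (2 ^ k)"
    proof
      fix j assume j: "j \<in> {1..r}"
      define i where "i = j - 1"
      have i: "i \<le> m" "j = Suc i"
        using j m(2) by (auto simp: i_def)
      \<comment> \<open>The residue at distance \<open>2 ^ i\<close> from \<open>t\<close> has valuation \<open>i\<close>;
        for \<open>i = k\<close> it is \<open>t\<close> itself.\<close>
      define x where "x = (t + 2 ^ i) mod 2 ^ k"
      have "[x - t = t + 2 ^ i - t] (mod 2 ^ k)"
        unfolding x_def by (intro cong_diff) (simp_all add: cong_def)
      then have "capped_val m (x - t) = i"
        using capped_val_cong[OF _ m(1)] capped_val_power[OF i(1)] by fastforce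
      moreover have "x \<in> Zmod (2 ^ k)"
        by (simp add: carrier_residue_ring_eq x_def)
      ultimately show "j \<in> c ` Zmod (2 ^ k)"
        using i(2) by (auto simp: c_def image_iff)
    qed
  qed
  moreover have "\<not> has_rainbow_solution (2 ^ k) a1 a2 a3 b c"
    using capped_val_solution[OF odd _ m(1)] linear_cong_translate[OF t]
    by (auto simp: has_rainbow_solution_def is_solution_def card_three_iff c_def)
  ultimately show thesis
    using that by (simp add: exact_coloring_def)
qed

section \<open>The upper bound\<close>

text \<open>
  Colourings of the residues modulo \<open>2 ^ k\<close> appear as \<open>2 ^ k\<close>-periodic colourings of the integers:
  then restricting to the even residues is just composition with doubling.
\<close>

lemma card_range_rainbow_free:
  fixes a1 a2 a3 :: int and c :: "int \<Rightarrow> 'a"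
  assumes odd: "odd a1" "odd a2" "odd a3"
    and "\<And>x y. [x = y] (mod 2 ^ k) \<Longrightarrow> c x = c y"
    and "\<And>x y z. 2 ^ k dvd a1 * x + a2 * y + a3 * z \<Longrightarrow> c x = c y \<or> c x = c z \<or> c y = c z"
  shows "finite (range c) \<and> card (range c) \<le> k + 1"
  using assms(4,5)
proof (induction k arbitrary: c)
  case 0
  then have "c x = c 0" for x
    by simp
  then have "range c = {c 0}"
    by auto
  then show ?case
    by simp
next
  case (Suc k)
  let ?E = "range (\<lambda>x. c (2 * x))"
  have E: "finite ?E \<and> card ?E \<le> k + 1"
  proof (rule Suc.IH)
    show "c (2 * x) = c (2 * y)" if "[x = y] (mod 2 ^ k)" for x y
    proof (rule Suc.prems(1))
      have "2 * 2 ^ k dvd 2 * (x - y)"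
        using that unfolding cong_iff_dvd_diff by (rule mult_dvd_mono[OF dvd_refl])
      then show "[2 * x = 2 * y] (mod 2 ^ Suc k)"
        by (simp only: cong_iff_dvd_diff power_Suc right_diff_distrib)
    qed
    show "c (2 * x) = c (2 * y) \<or> c (2 * x) = c (2 * z) \<or> c (2 * y) = c (2 * z)"
      if "2 ^ k dvd a1 * x + a2 * y + a3 * z" for x y z
    proof (rule Suc.prems(2))
      have "a1 * (2 * x) + a2 * (2 * y) + a3 * (2 * z) = 2 * (a1 * x + a2 * y + a3 * z)"
        by (simp add: algebra_simps)
      then show "2 ^ Suc k dvd a1 * (2 * x) + a2 * (2 * y) + a3 * (2 * z)"
        using that by (simp only: power_Suc mult_dvd_mono dvd_refl)
    qed
  qed
  have odd_new: "odd x" if "c x \<notin> ?E" for x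
    using that by (auto elim!: evenE)
  have one_new: "c x = c y" if new: "c x \<notin> ?E" "c y \<notin> ?E" for x y
  proof -
    obtain z where "[a3 * z = - (a1 * x + a2 * y)] (mod 2 ^ Suc k)"
      using odd(3) by (rule odd_linear_congruence_solvable)
    then have sol: "2 ^ Suc k dvd a1 * x + a2 * y + a3 * z"
      by (simp add: cong_iff_dvd_diff algebra_simps)
    then have "even (a1 * x + a2 * y + a3 * z)"
      unfolding power_Suc by (rule dvd_mult_left)
    then have "even z"
      using odd odd_new[OF new(1)] odd_new[OF new(2)] by simp
    then have "c z \<in> ?E"
      by (auto elim!: evenE)
    then show ?thesis
      using Suc.prems(2)[OF sol] new by auto
  qed
  obtain d where d: "range c \<subseteq> insert d ?E"
  proof (cases "range c \<subseteq> ?E")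
    case True
    then show thesis
      using that by blast
  next
    case False
    then obtain x where "c x \<notin> ?E"
      by blast
    then show thesis
      using that[of "c x"] one_new[of _ x] by blast
  qed
  have "finite (range c)"
    using d E finite_subset by blast
  moreover have "card (range c) \<le> card (insert d ?E)"
    using d E by (intro card_mono) auto
  moreover have "card (insert d ?E) \<le> Suc (card ?E)"
    by (rule card_insert_le_m1) auto
  ultimately show ?case
    using E by linarith
qed

lemma exact_coloring_without_rainbow_le:
  fixes a1 a2 a3 b :: int
  assumes odd: "odd a1" "odd a2" "odd a3"
    and exact: "exact_coloring (2 ^ k) r c"
    and no_rainbow: "\<not> has_rainbow_solution (2 ^ k) a1 a2 a3 b c"
  shows "r \<le> k + 1"
proof -
  have "odd (a1 + a2 + a3)"
    using odd by simp
  then obtain t where t: "[(a1 + a2 + a3) * t = b] (mod 2 ^ k)"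
    by (rule odd_linear_congruence_solvable)
  \<comment> \<open>The periodic extension of \<open>c\<close>, translated so that the equation becomes homogeneous.\<close>
  define d where "d x = c ((x + t) mod 2 ^ k)" for x
  have residue: "x mod 2 ^ k \<in> Zmod (2 ^ k)" for x
    by (simp add: carrier_residue_ring_eq)
  have "finite (range d) \<and> card (range d) \<le> k + 1"
  proof (rule card_range_rainbow_free[OF odd])
    show "d x = d y" if "[x = y] (mod 2 ^ k)" for x y
      using cong_add[OF that cong_refl[of t]] by (simp add: d_def cong_def)
    show "d x = d y \<or> d x = d z \<or> d y = d z" if "2 ^ k dvd a1 * x + a2 * y + a3 * z" for x y z
    proof -
      let ?s = "\<lambda>x. (x + t) mod 2 ^ k"
      have "[a1 * (x + t) + a2 * (y + t) + a3 * (z + t) = b] (mod 2 ^ k)"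
        using that linear_cong_translate[OF t] by simp
      moreover have "[a1 * ?s x + a2 * ?s y + a3 * ?s z
          = a1 * (x + t) + a2 * (y + t) + a3 * (z + t)] (mod 2 ^ k)"
        by (intro cong_add cong_mult cong_refl) (simp_all add: cong_def)
      ultimately have "is_solution (2 ^ k) a1 a2 a3 b (?s x) (?s y) (?s z)"
        using residue cong_trans unfolding is_solution_def by fastforce
      then show ?thesis
        using no_rainbow unfolding has_rainbow_solution_def card_three_iff d_def by blast
    qed
  qed
  moreover have "{1..r} \<subseteq> range d"
  proof
    fix j assume "j \<in> {1..r}"
    then obtain x where "x \<in> Zmod (2 ^ k)" "j = c x"
      using exact unfolding exact_coloring_def by blast
    then have "j = d (x - t)"
      by (simp add: d_def carrier_residue_ring_eq)
    then show "j \<in> range d"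
      by blast
  qed
  ultimately have "card {1..r} \<le> k + 1"
    using card_mono le_trans by blast
  then show ?thesis
    by simp
qed

section \<open>The rainbow number\<close>

theorem theorem3p1:
  fixes \<alpha> :: nat and a1 a2 a3 b :: int
  assumes "\<alpha> \<ge> 1"
    and "odd (a1 * a2 * a3)"
  shows "rainbow_number (2 ^ \<alpha>) a1 a2 a3 b = \<alpha> + 2"
proof -
  have odd: "odd a1" "odd a2" "odd a3"
    using assms(2) by auto
  show ?thesis
  proof (cases "\<exists>c. exact_coloring (2 ^ \<alpha>) (2 ^ \<alpha>) c
      \<and> \<not> has_rainbow_solution (2 ^ \<alpha>) a1 a2 a3 b c")
    case True
    \<comment> \<open>The upper bound and \<open>\<alpha> < 2 ^ \<alpha>\<close> leave only \<open>2 ^ \<alpha> = \<alpha> + 1\<close>, and then the conventional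
      value \<open>2 ^ \<alpha> + 1\<close> is the asserted one.\<close>
    then have "(2 :: nat) ^ \<alpha> \<le> \<alpha> + 1"
      using exact_coloring_without_rainbow_le[OF odd] by blast
    moreover have "\<alpha> < (2 :: nat) ^ \<alpha>"
      by (rule less_exp)
    ultimately have "2 ^ \<alpha> = \<alpha> + 1"
      by linarith
    with True show ?thesis
      unfolding rainbow_number_def by simp
  next
    case False
    have "(LEAST r. 0 < r \<and>
        (\<forall>c. exact_coloring (2 ^ \<alpha>) r c \<longrightarrow> has_rainbow_solution (2 ^ \<alpha>) a1 a2 a3 b c)) = \<alpha> + 2"
    proof (rule Least_equality)
      show "0 < \<alpha> + 2 \<and> (\<forall>c. exact_coloring (2 ^ \<alpha>) (\<alpha> + 2) c
          \<longrightarrow> has_rainbow_solution (2 ^ \<alpha>) a1 a2 a3 b c)"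
        using exact_coloring_without_rainbow_le[OF odd] by fastforce
      show "\<alpha> + 2 \<le> r" if "0 < r \<and> (\<forall>c. exact_coloring (2 ^ \<alpha>) r c
          \<longrightarrow> has_rainbow_solution (2 ^ \<alpha>) a1 a2 a3 b c)" for r
      proof (rule ccontr)
        assume "\<not> \<alpha> + 2 \<le> r"
        then have "0 < r" "r \<le> \<alpha> + 1"
          using that by simp_all
        then show False
          using exact_coloring_without_rainbow[OF odd, of r \<alpha> b] that by metis
      qed
    qed
    then show ?thesis
      unfolding rainbow_number_def by (simp only: if_not_P[OF False])
  qed
qed

end
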